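(* Let $G=(V,E)$ be a locally finite graph and let $x,y\in V$ with $x\sim y$. Then $$\kappa_p(x,y)=(1-p)\,\kappa(x,y)\qquad\text{for all } p\in\left[\frac{1}{\max\{d_x,d_y\}+1},1\right].$$ As a consequence, if $G$ is $d$-regular, then for every edge $x\sim y$, $$\kappa(x,y)=2\kappa_{\frac12}(x,y)=\frac{d+1}{d}\,\kappa_{\frac{1}{d+1}}(x,y).$$
   Context: Graphs have no multiple edges or self loops (and are undirected). $x\sim y$ means that $x$ and $y$ are joined by an edge; $d_x$ is the degree of $x$; $d(x,y)$ is the combinatorial (shortest path) distance, with $d(x,y)=\infty$ if there is no path. A graph is $d$-regular if all its vertices have degree $d$. For $x\in V$ with $d_x\ge 1$ and $p\in[0,1]$, $\mu_x^p$ is the probability measure on $V$ with $\mu_x^p(x)=p$, $\mu_x^p(z)=\frac{1-p}{d_x}$ for $z\sim x$, and $\mu_x^p(z)=0$ otherwise. For probability measures $\mu_1,\mu_2$ on $V$, $W_1(\mu_1,\mu_2)=\inf_{\pi}\sum_{u\in V}\sum_{v\in V}d(u,v)\pi(u,v)$, the infimum being over all $\pi:V\times V\to[0,1]$ with $\sum_{v}\pi(u,v)=\mu_1(u)$ for all $u$ and $\sum_{u}\pi(u,v)=\mu_2(v)$ for all $v$ (convention $\infty\cdot 0=0$). For an edge $x\sim y$, $\kappa_p(x,y)=1-W_1(\mu_x^p,\mu_y^p)$ and $\kappa(x,y)=\lim_{p\to1}\frac{\kappa_p(x,y)}{1-p}$. *)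

theory Defs
  imports "HOL-Analysis.Analysis"
begin

locale simple_graph =
  fixes V :: "'a set" and E :: "'a \<Rightarrow> 'a \<Rightarrow> bool"
  assumes edge_in_V: "E u v \<Longrightarrow> u \<in> V \<and> v \<in> V"
    and edge_sym: "E u v \<Longrightarrow> E v u"
    and no_loops: "\<not> E u u"

definition locally_finite :: "'a set \<Rightarrow> ('a \<Rightarrow> 'a \<Rightarrow> bool) \<Rightarrow> bool" where
  "locally_finite V E \<longleftrightarrow> (\<forall>v\<in>V. finite {z. E v z})"

definition vertex_degree :: "('a \<Rightarrow> 'a \<Rightarrow> bool) \<Rightarrow> 'a \<Rightarrow> nat" where
  "vertex_degree E v = card {z. E v z}"

definition regular_graph :: "'a set \<Rightarrow> ('a \<Rightarrow> 'a \<Rightarrow> bool) \<Rightarrow> nat \<Rightarrow> bool" where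
  "regular_graph V E d \<longleftrightarrow> (\<forall>v\<in>V. vertex_degree E v = d)"

(* The n-th relational power of E relates the end points of the walks with n edges;
   the infimum of the empty set in enat is \<infinity>. *)
definition graph_dist :: "('a \<Rightarrow> 'a \<Rightarrow> bool) \<Rightarrow> 'a \<Rightarrow> 'a \<Rightarrow> enat" where
  "graph_dist E u v = (INF n \<in> {n. (E ^^ n) u v}. enat n)"

(* Probability measures on V are given by their point masses. *)
definition idle_measure :: "('a \<Rightarrow> 'a \<Rightarrow> bool) \<Rightarrow> real \<Rightarrow> 'a \<Rightarrow> 'a \<Rightarrow> real" where
  "idle_measure E p x z =
     (if z = x then p else if E x z then (1 - p) / real (vertex_degree E x) else 0)"

definition transport_plan ::
    "'a set \<Rightarrow> ('a \<Rightarrow> real) \<Rightarrow> ('a \<Rightarrow> real) \<Rightarrow> ('a \<Rightarrow> 'a \<Rightarrow> real) \<Rightarrow> bool" where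
  "transport_plan V \<mu>1 \<mu>2 \<pi> \<longleftrightarrow>
     (\<forall>u\<in>V. \<forall>v\<in>V. \<pi> u v \<in> {0..1}) \<and>
     (\<forall>u\<in>V. ((\<lambda>v. \<pi> u v) has_sum \<mu>1 u) V) \<and>
     (\<forall>v\<in>V. ((\<lambda>u. \<pi> u v) has_sum \<mu>2 v) V)"

(* In ennreal every sum exists and \<infinity> * 0 = 0. *)
definition wasserstein ::
    "'a set \<Rightarrow> ('a \<Rightarrow> 'a \<Rightarrow> bool) \<Rightarrow> ('a \<Rightarrow> real) \<Rightarrow> ('a \<Rightarrow> real) \<Rightarrow> ennreal" where
  "wasserstein V E \<mu>1 \<mu>2 =
     (INF \<pi> \<in> {\<pi>. transport_plan V \<mu>1 \<mu>2 \<pi>}.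
        \<Sum>\<^sub>\<infinity>u\<in>V. \<Sum>\<^sub>\<infinity>v\<in>V. ennreal_of_enat (graph_dist E u v) * ennreal (\<pi> u v))"

definition idle_curvature ::
    "'a set \<Rightarrow> ('a \<Rightarrow> 'a \<Rightarrow> bool) \<Rightarrow> real \<Rightarrow> 'a \<Rightarrow> 'a \<Rightarrow> ereal" where
  "idle_curvature V E p x y =
     1 - enn2ereal (wasserstein V E (idle_measure E p x) (idle_measure E p y))"

(* The idleness p ranges over [0,1], so the limit p \<rightarrow> 1 is taken from the left. *)
definition curvature :: "'a set \<Rightarrow> ('a \<Rightarrow> 'a \<Rightarrow> bool) \<Rightarrow> 'a \<Rightarrow> 'a \<Rightarrow> ereal" where
  "curvature V E x y = Lim (at_left 1) (\<lambda>p. idle_curvature V E p x y / ereal (1 - p))"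

end

theory Submission
  imports Defs
begin

text \<open>Let \<open>D = max d\<^sub>x d\<^sub>y\<close> and \<open>p\<^sub>0 = 1 / (D + 1)\<close>.  For \<open>t = (1 - p') / (1 - p)\<close> one has
  \<open>\<mu>\<^sub>x\<^sup>p\<^sup>' = t \<mu>\<^sub>x\<^sup>p + (1 - t) \<delta>\<^sub>x\<close>, and likewise for \<open>y\<close>.  Hence a plan \<open>\<pi>\<close> for \<open>p\<close> gives the plan
  \<open>t \<pi> + (1 - t) \<delta>\<^sub>(\<^sub>x\<^sub>,\<^sub>y\<^sub>)\<close> for \<open>p'\<close>, provided that \<open>t - 1 \<le> t \<pi>(x,y)\<close>, and the cost minus \<open>1\<close> scales by
  \<open>t\<close>.  If \<open>\<pi>(x,y) \<ge> p - (1 - p) / D\<close>, this is possible for all \<open>p'\<close> in \<open>[p\<^sub>0, 1]\<close>; applied in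
  both directions it shows that \<open>(1 - W(p)) / (1 - p)\<close> is constant on \<open>[p\<^sub>0, 1)\<close>.

  Such a plan exists at no extra cost when \<open>p \<ge> p\<^sub>0\<close>.  By symmetry \<open>d\<^sub>y \<le> d\<^sub>x\<close>.  Then the mass at \<open>y\<close>
  and at the common neighbours does not exceed the mass required there, so by the triangle
  inequality it may be assumed to stay.  The remaining mass sent to \<open>y\<close> comes from \<open>x\<close> or from
  neighbours \<open>u\<close> of \<open>x\<close> at distance at least \<open>2\<close> from \<open>y\<close>, and replacing \<open>u \<rightarrow> y\<close>, \<open>x \<rightarrow> v\<close> by
  \<open>u \<rightarrow> v\<close>, \<open>x \<rightarrow> y\<close> is never more expensive.\<close>

section \<open>Finite transport plans and rerouting of mass\<close>

definition finite_plan :: "'a set \<Rightarrow> ('a \<Rightarrow> real) \<Rightarrow> ('a \<Rightarrow> real) \<Rightarrow> ('a \<Rightarrow> 'a \<Rightarrow> real) \<Rightarrow> bool" where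
  "finite_plan F A B \<pi> \<longleftrightarrow>
     (\<forall>u\<in>F. \<forall>v\<in>F. 0 \<le> \<pi> u v) \<and>
     (\<forall>u\<in>F. (\<Sum>v\<in>F. \<pi> u v) = A u) \<and>
     (\<forall>v\<in>F. (\<Sum>u\<in>F. \<pi> u v) = B v)"

definition plan_cost :: "'a set \<Rightarrow> ('a \<Rightarrow> 'a \<Rightarrow> real) \<Rightarrow> ('a \<Rightarrow> 'a \<Rightarrow> real) \<Rightarrow> real" where
  "plan_cost F d \<pi> = (\<Sum>u\<in>F. \<Sum>v\<in>F. d u v * \<pi> u v)"

lemma finite_plan_transpose:
  "finite_plan F A B \<pi> \<Longrightarrow> finite_plan F B A (\<lambda>u v. \<pi> v u)"
  by (auto simp: finite_plan_def)

lemma plan_cost_transpose: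
  assumes "\<And>u v. d u v = d v u"
  shows "plan_cost F d (\<lambda>u v. \<pi> v u) = plan_cost F d \<pi>"
  unfolding plan_cost_def by (subst sum.swap) (simp add: assms)

text \<open>Mass going from \<open>a\<close> to some \<open>v\<close> and from some \<open>u\<close> to \<open>b\<close> is rerouted along \<open>a \<rightarrow> b\<close> and
  \<open>u \<rightarrow> v\<close>, spread proportionally over all such pairs.  The correction has rank one and both
  factors have sum \<open>0\<close>, so that the marginals do not change.\<close>

lemma exchange:
  fixes d \<pi> :: "'a \<Rightarrow> 'a \<Rightarrow> real"
  assumes fin: "finite F" and ab: "a \<in> F" "b \<in> F" and U: "U \<subseteq> F - {a}"
    and plan: "finite_plan F A B \<pi>"
    and cond: "\<And>u v. u \<in> U \<Longrightarrow> v \<in> F \<Longrightarrow> v \<noteq> b \<Longrightarrow> \<pi> u b > 0 \<Longrightarrow> \<pi> a v > 0 \<Longrightarrow>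
                 d u v + d a b \<le> d u b + d a v"
  obtains \<pi>' where "finite_plan F A B \<pi>'" "plan_cost F d \<pi>' \<le> plan_cost F d \<pi>"
    "\<pi>' a b = \<pi> a b + min (\<Sum>u\<in>U. \<pi> u b) (\<Sum>v\<in>F - {b}. \<pi> a v)"
    "\<And>u v. u \<noteq> a \<Longrightarrow> \<pi> u b = 0 \<Longrightarrow> \<pi>' u v = \<pi> u v"
proof -
  have nn: "\<And>u v. u \<in> F \<Longrightarrow> v \<in> F \<Longrightarrow> 0 \<le> \<pi> u v"
    and row: "\<And>u. u \<in> F \<Longrightarrow> (\<Sum>v\<in>F. \<pi> u v) = A u"
    and col: "\<And>v. v \<in> F \<Longrightarrow> (\<Sum>u\<in>F. \<pi> u v) = B v"
    using plan by (auto simp: finite_plan_def)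
  define I where "I = (\<Sum>u\<in>U. \<pi> u b)"
  define J where "J = (\<Sum>v\<in>F - {b}. \<pi> a v)"
  \<comment> \<open>Chosen so that the correction at \<open>(a, b)\<close>, which is
    \<open>r * (I * J)\<close>, equals \<open>min I J\<close>. If \<open>I\<close> or
    \<open>J\<close> is 0, division by zero gives \<open>r = 0\<close>, and nothing moves.\<close>
  define r where "r = min I J / (I * J)"
  define g where "g u = (if u \<in> U then \<pi> u b else 0)" for u
  define h where "h v = (if v \<noteq> b then \<pi> a v else 0)" for v
  define G where "G u = g u - (if u = a then I else 0)" for u
  define H where "H v = h v - (if v = b then J else 0)" for v
  define \<pi>' where "\<pi>' u v = \<pi> u v + r * (G u * H v)" for u v
  have aU: "a \<notin> U" and UF: "U \<subseteq> F" using U by auto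
  have I0: "I \<ge> 0" unfolding I_def by (rule sum_nonneg) (use UF nn ab in auto)
  have J0: "J \<ge> 0" unfolding J_def by (rule sum_nonneg) (use nn ab in auto)
  have r0: "r \<ge> 0" using I0 J0 by (simp add: r_def)
  have rIJ: "r * (I * J) = min I J" using I0 J0 by (auto simp: r_def min_def)
  have rI: "r * I \<le> 1" and rJ: "r * J \<le> 1" using I0 J0 by (auto simp: r_def min_def divide_simps)
  have g0: "g u \<ge> 0" if "u \<in> F" for u using that nn ab by (auto simp: g_def)
  have h0: "h v \<ge> 0" if "v \<in> F" for v using that nn ab by (auto simp: h_def)
  have sg: "(\<Sum>u\<in>F. g u) = I"
    unfolding I_def g_def using fin UF by (simp add: sum.If_cases Int_absorb1)
  have sh: "(\<Sum>v\<in>F. h v) = J"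
    unfolding J_def h_def using fin ab by (simp add: sum.If_cases Diff_eq Collect_neg_eq)
  have sG: "(\<Sum>u\<in>F. G u) = 0"
    unfolding G_def using fin ab by (simp add: sum_subtractf sg)
  have sH: "(\<Sum>v\<in>F. H v) = 0"
    unfolding H_def using fin ab by (simp add: sum_subtractf sh)
  have nn': "0 \<le> \<pi>' u v" if "u \<in> F" "v \<in> F" for u v
  proof -
    have ga: "g a = 0" using aU by (simp add: g_def)
    have hb: "h b = 0" by (simp add: h_def)
    have p0: "0 \<le> \<pi> u v" using nn that by auto
    \<comment> \<open>\<open>G\<close> is negative at most at \<open>a\<close> and \<open>H\<close>
      at most at \<open>b\<close>, so mass is lost only in row \<open>a\<close> and column
      \<open>b\<close> away from \<open>(a, b)\<close>. There \<open>r * I \<le> 1\<close> and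
      \<open>r * J \<le> 1\<close> ensure that no more is taken than is present.\<close>
    consider "u = a" "v = b" | "u = a" "v \<noteq> b" | "u \<noteq> a" "v = b" | "u \<noteq> a" "v \<noteq> b" by auto
    then show ?thesis
    proof cases
      case 1
      then show ?thesis using p0 r0 I0 J0 ga hb by (simp add: \<pi>'_def G_def H_def)
    next
      case 2
      then have "\<pi>' u v = (1 - r * I) * \<pi> u v"
        by (simp add: \<pi>'_def G_def H_def ga h_def algebra_simps)
      then show ?thesis using rI p0 by simp
    next
      case 3
      then have "\<pi>' u v = \<pi> u v - r * J * g u"
        by (simp add: \<pi>'_def G_def H_def hb algebra_simps)
      moreover have "r * J * g u \<le> g u"
        using mult_right_mono[OF rJ g0[OF that(1)]] by simp
      moreover have "g u \<le> \<pi> u v" using 3 p0 by (simp add: g_def)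
      ultimately show ?thesis by linarith
    next
      case 4
      then show ?thesis using p0 r0 g0 h0 that by (simp add: \<pi>'_def G_def H_def)
    qed
  qed
  have row': "(\<Sum>v\<in>F. \<pi>' u v) = A u" if "u \<in> F" for u
    unfolding \<pi>'_def using row[OF that] sH
    by (simp add: sum.distrib flip: sum_distrib_left)
  have col': "(\<Sum>u\<in>F. \<pi>' u v) = B v" if "v \<in> F" for v
    unfolding \<pi>'_def using col[OF that] sG
    by (simp add: sum.distrib flip: sum_distrib_left sum_distrib_right)
  have sumH: "(\<Sum>v\<in>F. d u v * H v) = (\<Sum>v\<in>F. h v * (d u v - d u b))" for u
  proof -
    have "(\<Sum>v\<in>F. d u v * H v) = (\<Sum>v\<in>F. d u v * h v - (if v = b then d u v * J else 0))"
      unfolding H_def by (intro sum.cong) (auto simp: algebra_simps)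
    also have "\<dots> = (\<Sum>v\<in>F. d u v * h v) - d u b * (\<Sum>v\<in>F. h v)"
      using fin ab by (simp add: sum_subtractf sh)
    finally show ?thesis
      by (simp add: sum_distrib_left sum_distrib_right sum_subtractf right_diff_distrib mult.commute)
  qed
  have sumG: "(\<Sum>u\<in>F. e u * G u) = (\<Sum>u\<in>F. g u * (e u - e a))" for e :: "'a \<Rightarrow> real"
  proof -
    have "(\<Sum>u\<in>F. e u * G u) = (\<Sum>u\<in>F. e u * g u - (if u = a then e u * I else 0))"
      unfolding G_def by (intro sum.cong) (auto simp: algebra_simps)
    also have "\<dots> = (\<Sum>u\<in>F. e u * g u) - e a * (\<Sum>u\<in>F. g u)"
      using fin ab by (simp add: sum_subtractf sg)
    finally show ?thesis
      by (simp add: sum_distrib_left sum_distrib_right sum_subtractf right_diff_distrib mult.commute)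
  qed
  \<comment> \<open>The cost changes by \<open>r\<close> times the pairing of \<open>d\<close> with
    \<open>G\<close> and \<open>H\<close>. By \<open>sumG\<close> and \<open>sumH\<close> this is a
    sum of the differences controlled by \<open>cond\<close>, with weights
    \<open>g u * h v\<close>.\<close>
  have "plan_cost F d \<pi>' = plan_cost F d \<pi> + r * (\<Sum>u\<in>F. (\<Sum>v\<in>F. d u v * H v) * G u)"
    unfolding plan_cost_def \<pi>'_def
    by (simp add: sum.distrib sum_distrib_left sum_distrib_right algebra_simps)
  also have "(\<Sum>u\<in>F. (\<Sum>v\<in>F. d u v * H v) * G u) =
      (\<Sum>u\<in>F. g u * ((\<Sum>v\<in>F. h v * (d u v - d u b)) - (\<Sum>v\<in>F. h v * (d a v - d a b))))"
    unfolding sumG sumH ..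
  also have "\<dots> = (\<Sum>u\<in>F. \<Sum>v\<in>F. g u * h v * (d u v + d a b - d u b - d a v))"
    unfolding sum_subtractf[symmetric] sum_distrib_left
    by (intro sum.cong refl) (simp add: algebra_simps)
  also have "r * \<dots> \<le> 0"
  proof (rule mult_nonneg_nonpos[OF r0], rule sum_nonpos, rule sum_nonpos)
    fix u v assume uv: "u \<in> F" "v \<in> F"
    show "g u * h v * (d u v + d a b - d u b - d a v) \<le> 0"
    proof (cases "g u = 0 \<or> h v = 0")
      case True then show ?thesis by auto
    next
      case False
      then have "g u > 0" "h v > 0" using g0[OF uv(1)] h0[OF uv(2)] by auto
      moreover from this have "d u v + d a b \<le> d u b + d a v"
        by (intro cond) (auto simp: g_def h_def uv split: if_splits)
      ultimately show ?thesis by (simp add: mult_nonneg_nonpos)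
    qed
  qed
  finally have cost: "plan_cost F d \<pi>' \<le> plan_cost F d \<pi>" by simp
  show thesis
  proof (rule that)
    show "finite_plan F A B \<pi>'" using nn' row' col' by (simp add: finite_plan_def)
    show "plan_cost F d \<pi>' \<le> plan_cost F d \<pi>" by (rule cost)
    show "\<pi>' a b = \<pi> a b + min (\<Sum>u\<in>U. \<pi> u b) (\<Sum>v\<in>F - {b}. \<pi> a v)"
      using rIJ aU by (simp add: \<pi>'_def G_def H_def g_def h_def I_def J_def)
    show "\<pi>' u v = \<pi> u v" if "u \<noteq> a" "\<pi> u b = 0" for u v
      using that by (simp add: \<pi>'_def G_def g_def)
  qed
qed

text \<open>An exchange with \<open>a = b = s\<close> never raises the cost, by the triangle
  inequality. It adds the minimum of the inflow and the outflow of \<open>s\<close> to the mass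
  resting there; when \<open>A s \<le> B s\<close> this is the whole outflow.\<close>

lemma common_mass_stays:
  fixes d \<pi> :: "'a \<Rightarrow> 'a \<Rightarrow> real"
  assumes fin: "finite F" and T: "T \<subseteq> F" and plan: "finite_plan F A B \<pi>"
    and refl: "\<And>u. u \<in> F \<Longrightarrow> d u u = 0"
    and tri: "\<And>u v w. u \<in> F \<Longrightarrow> v \<in> F \<Longrightarrow> w \<in> F \<Longrightarrow> d u w \<le> d u v + d v w"
    and AB: "\<And>s. s \<in> T \<Longrightarrow> A s \<le> B s"
  obtains \<pi>' where "finite_plan F A B \<pi>'" "plan_cost F d \<pi>' \<le> plan_cost F d \<pi>"
    "\<And>s v. s \<in> T \<Longrightarrow> v \<in> F \<Longrightarrow> v \<noteq> s \<Longrightarrow> \<pi>' s v = 0"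
proof -
  have "finite T" using fin T by (rule rev_finite_subset)
  from this T AB have "\<exists>\<pi>'. finite_plan F A B \<pi>' \<and> plan_cost F d \<pi>' \<le> plan_cost F d \<pi> \<and>
    (\<forall>s\<in>T. \<forall>v\<in>F. v \<noteq> s \<longrightarrow> \<pi>' s v = 0)"
  proof (induction T rule: finite_induct)
    case empty
    then show ?case using plan by auto
  next
    case (insert s T)
    then obtain \<rho> where \<rho>: "finite_plan F A B \<rho>" "plan_cost F d \<rho> \<le> plan_cost F d \<pi>"
      and stay: "\<And>s v. s \<in> T \<Longrightarrow> v \<in> F \<Longrightarrow> v \<noteq> s \<Longrightarrow> \<rho> s v = 0"
      by auto
    have sF: "s \<in> F" and sAB: "A s \<le> B s" using insert.prems by auto
    obtain \<rho>' where \<rho>': "finite_plan F A B \<rho>'" "plan_cost F d \<rho>' \<le> plan_cost F d \<rho>"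
      and ss: "\<rho>' s s = \<rho> s s + min (\<Sum>u\<in>F - {s}. \<rho> u s) (\<Sum>v\<in>F - {s}. \<rho> s v)"
      and same: "\<And>u v. u \<noteq> s \<Longrightarrow> \<rho> u s = 0 \<Longrightarrow> \<rho>' u v = \<rho> u v"
    proof (rule exchange[OF fin sF sF _ \<rho>(1), of "F - {s}" d])
      show "d u v + d s s \<le> d u s + d s v" if "u \<in> F - {s}" "v \<in> F" for u v
        using tri[of u s v] refl[OF sF] that sF by auto
    qed auto
    have "(\<Sum>u\<in>F. \<rho> u s) = \<rho> s s + (\<Sum>u\<in>F - {s}. \<rho> u s)"
      "(\<Sum>v\<in>F. \<rho> s v) = \<rho> s s + (\<Sum>v\<in>F - {s}. \<rho> s v)"
      using fin sF by (simp_all add: sum.remove)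
    then have "\<rho>' s s = A s" using ss \<rho>(1) sF sAB by (auto simp: finite_plan_def)
    moreover have "A s = (\<Sum>v\<in>F. \<rho>' s v)" using \<rho>'(1) sF by (auto simp: finite_plan_def)
    moreover have "(\<Sum>v\<in>F. \<rho>' s v) = \<rho>' s s + (\<Sum>v\<in>F - {s}. \<rho>' s v)"
      using fin sF by (simp add: sum.remove)
    ultimately have "(\<Sum>v\<in>F - {s}. \<rho>' s v) = 0" by simp
    then have new: "\<rho>' s v = 0" if "v \<in> F" "v \<noteq> s" for v
      using that fin sF \<rho>'(1) by (subst (asm) sum_nonneg_eq_0_iff) (auto simp: finite_plan_def)
    \<comment> \<open>A vertex settled earlier sends nothing to \<open>s\<close>, so the exchange at
      \<open>s\<close> leaves its row unchanged.\<close>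
    have old: "\<rho>' s' v = 0" if "s' \<in> T" "v \<in> F" "v \<noteq> s'" for s' v
    proof -
      have "s' \<noteq> s" using that insert.hyps by auto
      then show ?thesis using same[of s' v] stay that sF by auto
    qed
    show ?case using \<rho> \<rho>' new old by (intro exI[of _ \<rho>']) auto
  qed
  then show thesis using that by blast
qed

section \<open>The combinatorial distance and its real version\<close>

lemma graph_dist_le: "(E ^^ n) u v \<Longrightarrow> graph_dist E u v \<le> enat n"
  unfolding graph_dist_def by (rule INF_lower) simp

text \<open>A finite infimum rules out the empty set, and in \<open>enat\<close> the infimum of a
  nonempty set is attained.\<close>

lemma graph_dist_walk:
  assumes "graph_dist E u v = enat n"
  shows "(E ^^ n) u v"
proof -
  let ?S = "enat ` {n. (E ^^ n) u v}"
  have "?S \<noteq> {}" using assms unfolding graph_dist_def by (auto simp only: Inf_enat_def split: if_splits)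
  then have "Inf ?S \<in> ?S" unfolding Inf_enat_def by (auto intro: LeastI)
  then show ?thesis using assms unfolding graph_dist_def by auto
qed

lemma graph_dist_triangle: "graph_dist E u w \<le> graph_dist E u v + graph_dist E v w"
proof (cases "graph_dist E u v")
  case m: (enat m)
  show ?thesis
  proof (cases "graph_dist E v w")
    case n: (enat n)
    have "(E ^^ (m + n)) u w"
      using graph_dist_walk[OF m] graph_dist_walk[OF n] by (auto simp: relpowp_add)
    from graph_dist_le[OF this] show ?thesis using m n by simp
  qed simp
qed simp

lemma relpowp_sym:
  assumes "\<And>u v. E u v \<Longrightarrow> E v u"
  shows "(E ^^ n) u v \<Longrightarrow> (E ^^ n) v u"
proof (induction n arbitrary: v)
  case (Suc n)
  then obtain w where w: "(E ^^ n) u w" "E w v" by auto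
  then have "(E ^^ n) w u" "E v w" using Suc.IH assms by auto
  then show ?case by (rule relpowp_Suc_I2[rotated])
qed simp

lemma graph_dist_sym:
  assumes "\<And>u v. E u v \<Longrightarrow> E v u"
  shows "graph_dist E u v = graph_dist E v u"
proof -
  have "{n. (E ^^ n) u v} = {n. (E ^^ n) v u}" using relpowp_sym[of E] assms by blast
  then show ?thesis by (simp add: graph_dist_def)
qed

text \<open>Meaningful only at finite distance, which holds between any two vertices of
  \<open>edge_nbhd E x y\<close> for an edge.\<close>

definition real_dist :: "('a \<Rightarrow> 'a \<Rightarrow> bool) \<Rightarrow> 'a \<Rightarrow> 'a \<Rightarrow> real" where
  "real_dist E u v = real (the_enat (graph_dist E u v))"

lemma real_dist_self: "real_dist E u u = 0"
  using graph_dist_le[of 0 E u u] by (cases "graph_dist E u u") (auto simp: real_dist_def)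

lemma real_dist_nonneg: "0 \<le> real_dist E u v"
  by (simp add: real_dist_def)

lemma real_dist_le: "(E ^^ n) u v \<Longrightarrow> real_dist E u v \<le> real n"
  using graph_dist_le[of n E u v] by (cases "graph_dist E u v") (auto simp: real_dist_def)

lemma real_dist_ge_1:
  assumes "u \<noteq> v" "graph_dist E u v \<noteq> \<infinity>"
  shows "1 \<le> real_dist E u v"
proof -
  obtain n where n: "graph_dist E u v = enat n" using assms by (cases "graph_dist E u v") auto
  with graph_dist_walk[OF n] assms(1) show ?thesis by (cases n) (auto simp: real_dist_def)
qed

lemma real_dist_ge_2:
  assumes "u \<noteq> v" "\<not> E u v" "graph_dist E u v \<noteq> \<infinity>"
  shows "2 \<le> real_dist E u v"
proof -
  obtain n where n: "graph_dist E u v = enat n" using assms by (cases "graph_dist E u v") auto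
  have "n \<noteq> 0" "n \<noteq> 1" using graph_dist_walk[OF n] assms by (metis relpowp_0_E, metis relpowp_1)
  then show ?thesis using n by (auto simp: real_dist_def)
qed

section \<open>Transport in the neighbourhood of an edge\<close>

text \<open>For adjacent \<open>x\<close> and \<open>y\<close> this union contains both end points,
  hence the supports of both idle measures.\<close>

definition edge_nbhd :: "('a \<Rightarrow> 'a \<Rightarrow> bool) \<Rightarrow> 'a \<Rightarrow> 'a \<Rightarrow> 'a set" where
  "edge_nbhd E x y = {z. E x z} \<union> {z. E y z}"

definition idle_plan :: "('a \<Rightarrow> 'a \<Rightarrow> bool) \<Rightarrow> real \<Rightarrow> 'a \<Rightarrow> 'a \<Rightarrow> ('a \<Rightarrow> 'a \<Rightarrow> real) \<Rightarrow> bool" where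
  "idle_plan E p x y = finite_plan (edge_nbhd E x y) (idle_measure E p x) (idle_measure E p y)"

definition idle_cost :: "('a \<Rightarrow> 'a \<Rightarrow> bool) \<Rightarrow> 'a \<Rightarrow> 'a \<Rightarrow> ('a \<Rightarrow> 'a \<Rightarrow> real) \<Rightarrow> real" where
  "idle_cost E x y = plan_cost (edge_nbhd E x y) (real_dist E)"

text \<open>The Wasserstein distance as a real number, taken over plans on a finite set. For
  \<open>p\<close> in \<open>[0, 1]\<close> the costs form a nonempty set bounded below by 0, so
  that \<open>Inf\<close> has its usual meaning.\<close>

definition idle_distance :: "('a \<Rightarrow> 'a \<Rightarrow> bool) \<Rightarrow> real \<Rightarrow> 'a \<Rightarrow> 'a \<Rightarrow> real" where
  "idle_distance E p x y = Inf (idle_cost E x y ` {\<pi>. idle_plan E p x y \<pi>})"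

locale graph_edge = simple_graph V E for V :: "'a set" and E :: "'a \<Rightarrow> 'a \<Rightarrow> bool" +
  fixes x y :: 'a
  assumes locally_finite: "locally_finite V E" and edge: "E x y"
begin

text \<open>Interpreting the locale at the reversed edge turns facts stated for \<open>x\<close>
  alone into facts about \<open>y\<close>.\<close>

lemma swap: "graph_edge V E y x"
  using locally_finite edge edge_sym by unfold_locales auto

lemma neq: "x \<noteq> y"
  using edge no_loops by auto

lemma finite_neighbours: "x \<in> V" "y \<in> V" "finite {z. E x z}" "finite {z. E y z}"
  using locally_finite edge edge_in_V by (auto simp: locally_finite_def)

lemma nbhd: "finite (edge_nbhd E x y)" "edge_nbhd E x y \<subseteq> V" "x \<in> edge_nbhd E x y" "y \<in> edge_nbhd E x y"
  using finite_neighbours edge edge_sym edge_in_V by (auto simp: edge_nbhd_def)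

lemma degree_pos: "vertex_degree E x \<ge> 1" "vertex_degree E y \<ge> 1"
  using finite_neighbours edge edge_sym
  by (auto simp: vertex_degree_def Suc_le_eq card_gt_0_iff)

text \<open>Neighbours of the same end point are joined by two edges through it, neighbours of
  different end points by three edges, the middle one being the given edge.\<close>

lemma nbhd_walk:
  assumes "u \<in> edge_nbhd E x y" "v \<in> edge_nbhd E x y"
  obtains n where "n \<le> 3" "(E ^^ n) u v"
proof -
  have two: "(E ^^ 2) a c" if "E a b" "E b c" for a b c
    using that by (auto simp: numeral_2_eq_2)
  have three: "(E ^^ 3) a d" if "E a b" "E b c" "E c d" for a b c d
    using that by (auto simp: numeral_3_eq_3)
  have "(E ^^ 2) u v \<or> (E ^^ 3) u v"
    using assms edge edge_sym two three unfolding edge_nbhd_def by blast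
  then show thesis using that[of 2] that[of 3] by auto
qed

lemma nbhd_dist_finite:
  assumes "u \<in> edge_nbhd E x y" "v \<in> edge_nbhd E x y"
  shows "graph_dist E u v \<noteq> \<infinity>"
  using nbhd_walk[OF assms] graph_dist_le[of _ E u v] by (metis enat_ord_code(5) enat.distinct(1))

lemma nbhd_real_dist_le_3:
  assumes "u \<in> edge_nbhd E x y" "v \<in> edge_nbhd E x y"
  shows "real_dist E u v \<le> 3"
proof -
  obtain n where n: "n \<le> 3" "(E ^^ n) u v" using nbhd_walk[OF assms] .
  then have "real_dist E u v \<le> real n" "real n \<le> 3" using real_dist_le[of n E u v] by auto
  then show ?thesis by linarith
qed

lemma nbhd_real_dist:
  assumes "u \<in> edge_nbhd E x y" "v \<in> edge_nbhd E x y"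
  shows "ennreal_of_enat (graph_dist E u v) = ennreal (real_dist E u v)"
  using nbhd_dist_finite[OF assms]
  by (cases "graph_dist E u v") (auto simp: real_dist_def ennreal_of_nat_eq_real_of_nat)

lemma nbhd_real_dist_triangle:
  assumes "u \<in> edge_nbhd E x y" "v \<in> edge_nbhd E x y" "w \<in> edge_nbhd E x y"
  shows "real_dist E u w \<le> real_dist E u v + real_dist E v w"
  using nbhd_dist_finite[of u v] nbhd_dist_finite[of v w] nbhd_dist_finite[of u w]
    graph_dist_triangle[of E u w v] assms
  by (cases "graph_dist E u v"; cases "graph_dist E v w"; cases "graph_dist E u w")
    (auto simp: real_dist_def)

lemma edge_real_dist: "real_dist E x y = 1"
  using real_dist_le[of 1 E x y] real_dist_ge_1[of x y E] edge neq nbhd nbhd_dist_finite[of x y]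
  by auto

lemma idle_measure_bounds:
  assumes "p \<in> {0..1}"
  shows "0 \<le> idle_measure E p x z" "idle_measure E p x z \<le> 1"
proof -
  have "(1 - p) / real (vertex_degree E x) \<le> 1 / 1"
    using assms degree_pos by (intro frac_le) auto
  then show "0 \<le> idle_measure E p x z" "idle_measure E p x z \<le> 1"
    using assms by (auto simp: idle_measure_def)
qed

lemma idle_measure_support:
  "z \<notin> edge_nbhd E x y \<Longrightarrow> idle_measure E p x z = 0"
  using nbhd(3) by (auto simp: idle_measure_def edge_nbhd_def)

lemma idle_measure_sum: "(\<Sum>z\<in>edge_nbhd E x y. idle_measure E p x z) = 1"
proof -
  have "(\<Sum>z\<in>edge_nbhd E x y. idle_measure E p x z) = (\<Sum>z\<in>insert x {z. E x z}. idle_measure E p x z)"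
    using nbhd by (intro sum.mono_neutral_right) (auto simp: idle_measure_def edge_nbhd_def)
  also have "\<dots> = p + (\<Sum>z\<in>{z. E x z}. idle_measure E p x z)"
    using finite_neighbours no_loops by (simp add: idle_measure_def)
  also have "(\<Sum>z\<in>{z. E x z}. idle_measure E p x z) = (\<Sum>z\<in>{z. E x z}. (1 - p) / real (vertex_degree E x))"
    using no_loops by (intro sum.cong) (auto simp: idle_measure_def)
  also have "p + \<dots> = 1"
    using degree_pos by (simp add: vertex_degree_def)
  finally show ?thesis .
qed

section \<open>Plans that send much mass along the edge\<close>

text \<open>Once \<open>y\<close> keeps its own mass \<open>q = (1 - p) / d_x\<close>, it still
  requires \<open>p - q\<close>, which is the claimed bound. A single exchange makes all of this
  come from \<open>x\<close>.\<close>

lemma heavy_edge_plan_aux: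
  assumes deg: "vertex_degree E y \<le> vertex_degree E x"
    and p: "1 / (real (vertex_degree E x) + 1) \<le> p" "p \<le> 1"
    and plan: "idle_plan E p x y \<pi>"
  obtains \<pi>' where "idle_plan E p x y \<pi>'" "idle_cost E x y \<pi>' \<le> idle_cost E x y \<pi>"
    "\<pi>' x y \<ge> p - (1 - p) / real (vertex_degree E x)"
proof -
  define F where "F = edge_nbhd E x y"
  define A where "A = idle_measure E p x"
  define B where "B = idle_measure E p y"
  define S where "S = {s. E x s \<and> (s = y \<or> E y s)}"
  define q where "q = (1 - p) / real (vertex_degree E x)"
  have F: "finite F" "x \<in> F" "y \<in> F" using nbhd by (auto simp: F_def)
  have SF: "S \<subseteq> F" by (auto simp: S_def F_def edge_nbhd_def)
  have dpos: "real (vertex_degree E x) > 0" "real (vertex_degree E y) > 0" using degree_pos by auto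
  have q0: "0 \<le> q" using p by (simp add: q_def)
  \<comment> \<open>A reformulation of the lower bound on \<open>p\<close>; it gives
    \<open>A y \<le> B y\<close>. The inequality \<open>qq\<close>, from the order of the degrees,
    does the same at the common neighbours.\<close>
  have qp: "q \<le> p" using p dpos by (simp add: q_def field_simps)
  have qq: "q \<le> (1 - p) / real (vertex_degree E y)"
    unfolding q_def using dpos deg p by (intro divide_left_mono) auto
  have AS: "A s = q" if "s \<in> S" for s
    using that no_loops by (auto simp: A_def S_def q_def idle_measure_def)
  have Ax: "A x = p" and By: "B y = p" by (auto simp: A_def B_def idle_measure_def)
  have AB: "A s \<le> B s" if "s \<in> S" for s
    using that qp qq AS[OF that] by (auto simp: B_def S_def idle_measure_def)
  have tri: "real_dist E u w \<le> real_dist E u v + real_dist E v w"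
    if "u \<in> F" "v \<in> F" "w \<in> F" for u v w
    using nbhd_real_dist_triangle that by (simp add: F_def)
  have fin_dist: "graph_dist E u v \<noteq> \<infinity>" if "u \<in> F" "v \<in> F" for u v
    using nbhd_dist_finite that by (simp add: F_def)
  have planF: "finite_plan F A B \<pi>" using plan by (simp add: idle_plan_def F_def A_def B_def)
  obtain \<rho> where \<rho>: "finite_plan F A B \<rho>" "plan_cost F (real_dist E) \<rho> \<le> plan_cost F (real_dist E) \<pi>"
    and stay: "\<And>s v. s \<in> S \<Longrightarrow> v \<in> F \<Longrightarrow> v \<noteq> s \<Longrightarrow> \<rho> s v = 0"
    using common_mass_stays[where d = "real_dist E", OF F(1) SF planF real_dist_self tri AB] by blast
  have nn: "0 \<le> \<rho> u v" and row: "(\<Sum>v\<in>F. \<rho> u v) = A u" and col: "(\<Sum>u\<in>F. \<rho> u v) = B v"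
    if "u \<in> F" "v \<in> F" for u v
    using \<rho>(1) that by (auto simp: finite_plan_def)
  have posA: "A u > 0" and posB: "B v > 0" if "u \<in> F" "v \<in> F" "\<rho> u v > 0" for u v
  proof -
    have "\<rho> u v \<le> (\<Sum>v\<in>F. \<rho> u v)" "\<rho> u v \<le> (\<Sum>u\<in>F. \<rho> u v)"
      using F nn that by (auto intro!: member_le_sum)
    then show "A u > 0" "B v > 0" using row col that by auto
  qed
  text \<open>A vertex \<open>u\<close> that still sends mass to \<open>y\<close> is at distance at least \<open>2\<close> from \<open>y\<close>.\<close>
  have cond: "real_dist E u v + real_dist E x y \<le> real_dist E u y + real_dist E x v"
    if u: "u \<in> F - {x, y}" and v: "v \<in> F" "v \<noteq> y" and pos: "\<rho> u y > 0" "\<rho> x v > 0" for u v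
  proof -
    have Exu: "E x u" using posA[of u y] u pos F by (auto simp: A_def idle_measure_def split: if_splits)
    moreover have "u \<notin> S" using stay[of u y] u pos F by auto
    ultimately have "\<not> E y u" by (auto simp: S_def)
    then have uy: "2 \<le> real_dist E u y"
      using u F edge_sym by (intro real_dist_ge_2 fin_dist) auto
    have Eyv: "E y v" using posB[of x v] v pos F by (auto simp: B_def idle_measure_def split: if_splits)
    \<comment> \<open>With \<open>d(x,y) = 1\<close> and \<open>d(u,y) \<ge> 2\<close> it suffices
      that \<open>d(u,v) \<le> d(x,v) + 1\<close>. In the three cases \<open>d(x,v)\<close> is at
      least 0, 1, 2 and \<open>d(u,v)\<close> at most 1, 2, 3.\<close>
    consider "v = x" | "v \<noteq> x" "E x v" | "v \<noteq> x" "\<not> E x v" by auto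
    then show ?thesis
    proof cases
      case 1
      have "real_dist E u x \<le> 1" using real_dist_le[of 1 E u x] Exu edge_sym by auto
      then show ?thesis using 1 uy edge_real_dist real_dist_self[of E x] by simp
    next
      case 2
      have "(E ^^ 2) u v" using Exu 2 edge_sym by (auto simp: numeral_2_eq_2)
      then have "real_dist E u v \<le> 2" using real_dist_le[of 2 E u v] by simp
      moreover have "1 \<le> real_dist E x v" using 2 v F by (intro real_dist_ge_1 fin_dist) auto
      ultimately show ?thesis using uy edge_real_dist by simp
    next
      case 3
      have "real_dist E u v \<le> 3" using nbhd_real_dist_le_3 u v by (simp add: F_def)
      moreover have "2 \<le> real_dist E x v" using 3 v F by (intro real_dist_ge_2 fin_dist) auto
      ultimately show ?thesis using uy edge_real_dist by simp
    qed
  qed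
  have U: "F - {x, y} \<subseteq> F - {x}" by auto
  \<comment> \<open>The sources to be replaced do not include \<open>y\<close>, whose own mass is
    already in place.\<close>
  obtain \<rho>' where \<rho>': "finite_plan F A B \<rho>'" "plan_cost F (real_dist E) \<rho>' \<le> plan_cost F (real_dist E) \<rho>"
    and xy: "\<rho>' x y = \<rho> x y + min (\<Sum>u\<in>F - {x, y}. \<rho> u y) (\<Sum>v\<in>F - {y}. \<rho> x v)"
  proof (rule exchange[where d = "real_dist E", OF F U \<rho>(1)])
    show "real_dist E u v + real_dist E x y \<le> real_dist E u y + real_dist E x v"
      if "u \<in> F - {x, y}" "v \<in> F" "v \<noteq> y" "\<rho> u y > 0" "\<rho> x v > 0" for u v
      using that by (rule cond)
  qed
  have "y \<in> S" using edge by (simp add: S_def)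
  have "(\<Sum>v\<in>F. \<rho> y v) = \<rho> y y"
    using F stay[OF \<open>y \<in> S\<close>] by (subst sum.remove[of _ y]) auto
  then have yy: "\<rho> y y = q" using row[of y y] F AS[OF \<open>y \<in> S\<close>] by simp
  have "F - {x} - {y} = F - {x, y}" by auto
  then have "(\<Sum>u\<in>F. \<rho> u y) = \<rho> x y + (\<rho> y y + (\<Sum>u\<in>F - {x, y}. \<rho> u y))"
    using F neq sum.remove[of F x "\<lambda>u. \<rho> u y"] sum.remove[of "F - {x}" y "\<lambda>u. \<rho> u y"] by simp
  then have I: "\<rho> x y + (\<Sum>u\<in>F - {x, y}. \<rho> u y) = p - q"
    using col[of y y] F yy By by simp
  have "\<rho> x y + (\<Sum>v\<in>F - {y}. \<rho> x v) = p"
    using row[of x x] F Ax sum.remove[of F y "\<rho> x"] by simp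
  \<comment> \<open>Adding the column sum to \<open>\<rho> x y\<close> gives \<open>p - q\<close>,
    adding the row sum gives \<open>p\<close>. As \<open>q \<ge> 0\<close>, the minimum is the
    column sum.\<close>
  then have "\<rho>' x y \<ge> p - q" using xy I q0 by (simp add: min_def)
  then show thesis
    using that[of \<rho>'] \<rho> \<rho>' by (simp add: idle_plan_def idle_cost_def F_def A_def B_def q_def)
qed

end

lemma edge_nbhd_commute: "edge_nbhd E x y = edge_nbhd E y x"
  by (auto simp: edge_nbhd_def)

lemma idle_plan_transpose: "idle_plan E p x y \<pi> \<Longrightarrow> idle_plan E p y x (\<lambda>u v. \<pi> v u)"
  unfolding idle_plan_def edge_nbhd_commute[of E x y] by (rule finite_plan_transpose)

context graph_edge
begin

lemma idle_cost_transpose: "idle_cost E y x (\<lambda>u v. \<pi> v u) = idle_cost E x y \<pi>"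
proof -
  have "real_dist E u v = real_dist E v u" for u v
    using graph_dist_sym[of E u v] edge_sym by (simp add: real_dist_def)
  then show ?thesis
    unfolding idle_cost_def edge_nbhd_commute[of E y x] by (rule plan_cost_transpose)
qed

text \<open>If \<open>y\<close> has the larger degree, the previous result is applied to the
  reversed edge and the transposed plan, whose cost is the same because the distance is
  symmetric.\<close>

lemma heavy_edge_plan:
  defines "D \<equiv> max (vertex_degree E x) (vertex_degree E y)"
  assumes p: "1 / (real D + 1) \<le> p" "p \<le> 1" and plan: "idle_plan E p x y \<pi>"
  obtains \<pi>' where "idle_plan E p x y \<pi>'" "idle_cost E x y \<pi>' \<le> idle_cost E x y \<pi>"
    "\<pi>' x y \<ge> p - (1 - p) / real D"
proof (cases "vertex_degree E y \<le> vertex_degree E x")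
  case True
  then have "D = vertex_degree E x" by (simp add: D_def)
  then show thesis using heavy_edge_plan_aux[OF True _ _ plan] p that by metis
next
  case False
  interpret S: graph_edge V E y x by (rule swap)
  have deg: "vertex_degree E x \<le> vertex_degree E y" and D: "D = vertex_degree E y"
    using False by (auto simp: D_def)
  from p have p': "1 / (real (vertex_degree E y) + 1) \<le> p" by (simp add: D)
  obtain \<rho> where \<rho>: "idle_plan E p y x \<rho>" "idle_cost E y x \<rho> \<le> idle_cost E y x (\<lambda>u v. \<pi> v u)"
    "\<rho> y x \<ge> p - (1 - p) / real (vertex_degree E y)"
    using S.heavy_edge_plan_aux[OF deg p' p(2) idle_plan_transpose[OF plan]] .
  show thesis
    using that[of "\<lambda>u v. \<rho> v u"] idle_plan_transpose[OF \<rho>(1)] \<rho>(2,3)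
      idle_cost_transpose[of \<pi>] S.idle_cost_transpose[of \<rho>] by (simp add: D)
qed

section \<open>Changing the idleness\<close>

text \<open>The mass \<open>1 - t\<close> placed at \<open>(x, y)\<close> may be negative;
  \<open>heavy\<close> says that this entry stays nonnegative. Each unit of it costs 1, the length
  of the edge.\<close>

lemma rescale_plan:
  assumes p: "p < 1" and t: "t = (1 - p') / (1 - p)" and t0: "0 \<le> t"
    and plan: "idle_plan E p x y \<pi>" and heavy: "t - 1 \<le> t * \<pi> x y"
  obtains \<pi>' where "idle_plan E p' x y \<pi>'" "idle_cost E x y \<pi>' = t * idle_cost E x y \<pi> + (1 - t)"
proof
  let ?\<pi> = "\<lambda>u v. t * \<pi> u v + (if u = x then if v = y then 1 - t else 0 else 0)"
  have meas: "idle_measure E p' z u = t * idle_measure E p z u + (if u = z then 1 - t else 0)" for z u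
  proof -
    have t1p: "t * (1 - p) = 1 - p'" using p by (simp add: t)
    then have "t * p + (1 - t) = p'" by (simp add: algebra_simps)
    then show ?thesis by (simp add: idle_measure_def times_divide_eq_right t1p)
  qed
  have sx: "(\<Sum>u\<in>edge_nbhd E x y. if u = x then if v = y then 1 - t else 0 else 0) = (if v = y then 1 - t else 0)" for v
    using nbhd by simp
  have sy: "(\<Sum>v\<in>edge_nbhd E x y. if u = x then if v = y then 1 - t else 0 else 0) = (if u = x then 1 - t else 0)" for u
    using nbhd by simp
  show "idle_plan E p' x y ?\<pi>"
    using plan heavy t0
    by (auto simp: idle_plan_def finite_plan_def sum.distrib sx sy meas simp flip: sum_distrib_left)
  have "(\<Sum>v\<in>edge_nbhd E x y. real_dist E u v * (if u = x then if v = y then 1 - t else 0 else 0)) =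
      (if u = x then 1 - t else 0)" for u
  proof -
    have "(\<Sum>v\<in>edge_nbhd E x y. real_dist E u v * (if u = x then if v = y then 1 - t else 0 else 0)) =
      (\<Sum>v\<in>edge_nbhd E x y. if v = y then (if u = x then real_dist E u v * (1 - t) else 0) else 0)"
      by (intro sum.cong) auto
    then show ?thesis using nbhd edge_real_dist by simp
  qed
  then have *: "(\<Sum>u\<in>edge_nbhd E x y. \<Sum>v\<in>edge_nbhd E x y.
      real_dist E u v * (if u = x then if v = y then 1 - t else 0 else 0)) = 1 - t"
    using nbhd by simp
  show "idle_cost E x y ?\<pi> = t * idle_cost E x y \<pi> + (1 - t)"
    unfolding idle_cost_def plan_cost_def
    by (simp only: distrib_left sum.distrib *) (simp add: sum_distrib_left mult.left_commute)
qed

section \<open>Reduction of the Wasserstein distance to finite plans\<close>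

lemma idle_plan_exists:
  assumes "p \<in> {0..1}"
  obtains \<pi> where "idle_plan E p x y \<pi>"
proof
  interpret S: graph_edge V E y x by (rule swap)
  show "idle_plan E p x y (\<lambda>u v. idle_measure E p x u * idle_measure E p y v)"
    unfolding idle_plan_def finite_plan_def
    using idle_measure_bounds[OF assms] S.idle_measure_bounds[OF assms] idle_measure_sum
      S.idle_measure_sum edge_nbhd_commute[of E y x]
    by (auto simp flip: sum_distrib_left sum_distrib_right)
qed

lemma idle_cost_nonneg: "idle_plan E p x y \<pi> \<Longrightarrow> 0 \<le> idle_cost E x y \<pi>"
  unfolding idle_cost_def plan_cost_def idle_plan_def finite_plan_def
  by (auto intro!: sum_nonneg mult_nonneg_nonneg real_dist_nonneg)

lemma idle_distance_le:
  assumes "idle_plan E p x y \<pi>"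
  shows "idle_distance E p x y \<le> idle_cost E x y \<pi>"
  unfolding idle_distance_def
proof (rule cInf_lower)
  show "bdd_below (idle_cost E x y ` {\<pi>. idle_plan E p x y \<pi>})"
    using idle_cost_nonneg by (intro bdd_belowI[of _ 0]) auto
qed (use assms in auto)

lemma idle_distance_greatest:
  assumes "p \<in> {0..1}" "\<And>\<pi>. idle_plan E p x y \<pi> \<Longrightarrow> c \<le> idle_cost E x y \<pi>"
  shows "c \<le> idle_distance E p x y"
  unfolding idle_distance_def
  by (rule cInf_greatest) (use idle_plan_exists[OF assms(1)] assms(2) in auto)

text \<open>Outside the neighbourhood the terms vanish, even at infinite distance, since \<infinity>
  * 0 = 0. Inside, all distances are finite and the sums can be computed in the reals.\<close>

lemma infsum_cost:
  assumes "\<And>u v. u \<in> V \<Longrightarrow> v \<in> V \<Longrightarrow> u \<notin> edge_nbhd E x y \<or> v \<notin> edge_nbhd E x y \<Longrightarrow> \<pi> u v = 0"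
    and "\<And>u v. u \<in> edge_nbhd E x y \<Longrightarrow> v \<in> edge_nbhd E x y \<Longrightarrow> 0 \<le> \<pi> u v"
  shows "(\<Sum>\<^sub>\<infinity>u\<in>V. \<Sum>\<^sub>\<infinity>v\<in>V. ennreal_of_enat (graph_dist E u v) * ennreal (\<pi> u v)) =
    ennreal (idle_cost E x y \<pi>)"
proof -
  let ?F = "edge_nbhd E x y"
  let ?f = "\<lambda>u v. ennreal_of_enat (graph_dist E u v) * ennreal (\<pi> u v)"
  have inner: "(\<Sum>\<^sub>\<infinity>v\<in>V. ?f u v) = (\<Sum>v\<in>?F. ?f u v)" if "u \<in> V" for u
  proof -
    have "(\<Sum>\<^sub>\<infinity>v\<in>V. ?f u v) = (\<Sum>\<^sub>\<infinity>v\<in>?F. ?f u v)"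
      using assms(1) that nbhd by (intro infsum_cong_neutral) auto
    then show ?thesis using nbhd by simp
  qed
  have "(\<Sum>\<^sub>\<infinity>u\<in>V. \<Sum>\<^sub>\<infinity>v\<in>V. ?f u v) = (\<Sum>\<^sub>\<infinity>u\<in>?F. \<Sum>v\<in>?F. ?f u v)"
    using assms(1) nbhd inner by (intro infsum_cong_neutral) (auto intro!: sum.neutral)
  also have "\<dots> = (\<Sum>u\<in>?F. \<Sum>v\<in>?F. ?f u v)" using nbhd by simp
  also have "\<dots> = (\<Sum>u\<in>?F. \<Sum>v\<in>?F. ennreal (real_dist E u v * \<pi> u v))"
    using assms(2) by (intro sum.cong refl) (simp add: nbhd_real_dist ennreal_mult real_dist_nonneg)
  also have "\<dots> = (\<Sum>u\<in>?F. ennreal (\<Sum>v\<in>?F. real_dist E u v * \<pi> u v))"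
    using assms(2) real_dist_nonneg by (intro sum.cong refl sum_ennreal mult_nonneg_nonneg)
  also have "\<dots> = ennreal (idle_cost E x y \<pi>)"
    unfolding idle_cost_def plan_cost_def
    using assms(2) real_dist_nonneg by (intro sum_ennreal sum_nonneg mult_nonneg_nonneg)
  finally show ?thesis .
qed

text \<open>A nonnegative row or column whose sum is 0 vanishes entrywise.\<close>

lemma transport_plan_support:
  assumes "transport_plan V (idle_measure E p x) (idle_measure E p y) \<pi>"
    and "u \<in> V" "v \<in> V" "u \<notin> edge_nbhd E x y \<or> v \<notin> edge_nbhd E x y"
  shows "\<pi> u v = 0"
proof -
  interpret S: graph_edge V E y x by (rule swap)
  have nn: "\<And>u v. u \<in> V \<Longrightarrow> v \<in> V \<Longrightarrow> 0 \<le> \<pi> u v"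
    and row: "((\<lambda>v. \<pi> u v) has_sum idle_measure E p x u) V"
    and col: "((\<lambda>u. \<pi> u v) has_sum idle_measure E p y v) V"
    using assms by (auto simp: transport_plan_def)
  from assms(4) show ?thesis
  proof
    assume "u \<notin> edge_nbhd E x y"
    then have "idle_measure E p x u = 0" by (rule idle_measure_support)
    then show ?thesis using nonneg_has_sum_le_0D[OF row, of v] nn assms by auto
  next
    assume "v \<notin> edge_nbhd E x y"
    then have "idle_measure E p y v = 0"
      by (intro S.idle_measure_support) (simp add: edge_nbhd_commute[of E y x])
    then show ?thesis using nonneg_has_sum_le_0D[OF col, of u] nn assms by auto
  qed
qed

lemma transport_plan_idle_plan:
  assumes tp: "transport_plan V (idle_measure E p x) (idle_measure E p y) \<pi>"
  shows "idle_plan E p x y \<pi>"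
proof -
  let ?F = "edge_nbhd E x y"
  have "(\<Sum>v\<in>?F. \<pi> u v) = idle_measure E p x u" if u: "u \<in> ?F" for u
  proof -
    have "((\<lambda>v. \<pi> u v) has_sum (\<Sum>v\<in>?F. \<pi> u v)) V"
      using transport_plan_support[OF tp] u nbhd by (intro has_sum_finite_neutralI) auto
    moreover have "((\<lambda>v. \<pi> u v) has_sum idle_measure E p x u) V"
      using tp u nbhd by (auto simp: transport_plan_def)
    ultimately show ?thesis by (rule has_sum_unique)
  qed
  moreover have "(\<Sum>u\<in>?F. \<pi> u v) = idle_measure E p y v" if v: "v \<in> ?F" for v
  proof -
    have "((\<lambda>u. \<pi> u v) has_sum (\<Sum>u\<in>?F. \<pi> u v)) V"
      using transport_plan_support[OF tp] v nbhd by (intro has_sum_finite_neutralI) auto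
    moreover have "((\<lambda>u. \<pi> u v) has_sum idle_measure E p y v) V"
      using tp v nbhd by (auto simp: transport_plan_def)
    ultimately show ?thesis by (rule has_sum_unique)
  qed
  moreover have "0 \<le> \<pi> u v" if "u \<in> ?F" "v \<in> ?F" for u v
    using tp subsetD[OF nbhd(2) that(1)] subsetD[OF nbhd(2) that(2)] by (simp add: transport_plan_def)
  ultimately show ?thesis by (simp add: idle_plan_def finite_plan_def)
qed

lemma idle_plan_transport_plan:
  assumes p: "p \<in> {0..1}" and plan: "idle_plan E p x y \<pi>"
  obtains \<pi>' where "transport_plan V (idle_measure E p x) (idle_measure E p y) \<pi>'"
    "idle_cost E x y \<pi>' = idle_cost E x y \<pi>"
proof
  interpret S: graph_edge V E y x by (rule swap)
  let ?F = "edge_nbhd E x y"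
  \<comment> \<open>The predicate \<open>idle_plan\<close> says nothing about values off the
    neighbourhood, so these are set to 0.\<close>
  let ?\<pi> = "\<lambda>u v. if u \<in> ?F \<and> v \<in> ?F then \<pi> u v else 0"
  have nn: "0 \<le> \<pi> u v" and row: "(\<Sum>v\<in>?F. \<pi> u v) = idle_measure E p x u"
    and col: "(\<Sum>u\<in>?F. \<pi> u v) = idle_measure E p y v" if "u \<in> ?F" "v \<in> ?F" for u v
    using plan that by (auto simp: idle_plan_def finite_plan_def)
  have le1: "\<pi> u v \<le> 1" if "u \<in> ?F" "v \<in> ?F" for u v
  proof -
    have "\<pi> u v \<le> (\<Sum>v\<in>?F. \<pi> u v)"
      using nbhd nn that by (auto intro!: member_le_sum)
    then show ?thesis using row[OF that] idle_measure_bounds(2)[OF p, of u] by simp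
  qed
  have row': "((\<lambda>v. ?\<pi> u v) has_sum idle_measure E p x u) V" for u
  proof (rule has_sum_finite_neutralI[OF nbhd(1,2)])
    show "idle_measure E p x u = (\<Sum>v\<in>?F. ?\<pi> u v)"
      using row[of u u] idle_measure_support[of u p] by (cases "u \<in> ?F") auto
  qed auto
  have col': "((\<lambda>u. ?\<pi> u v) has_sum idle_measure E p y v) V" for v
  proof (rule has_sum_finite_neutralI[OF nbhd(1,2)])
    show "idle_measure E p y v = (\<Sum>u\<in>?F. ?\<pi> u v)"
      using col[of v v] S.idle_measure_support[of v p] edge_nbhd_commute[of E y x]
      by (cases "v \<in> ?F") auto
  qed auto
  show "transport_plan V (idle_measure E p x) (idle_measure E p y) ?\<pi>"
    unfolding transport_plan_def using nn le1 row' col' by auto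
  show "idle_cost E x y ?\<pi> = idle_cost E x y \<pi>"
    unfolding idle_cost_def plan_cost_def by (intro sum.cong refl) auto
qed

lemma wasserstein_eq_idle_distance:
  assumes p: "p \<in> {0..1}"
  shows "wasserstein V E (idle_measure E p x) (idle_measure E p y) = ennreal (idle_distance E p x y)"
proof -
  let ?T = "transport_plan V (idle_measure E p x) (idle_measure E p y)"
  have cost: "(\<Sum>\<^sub>\<infinity>u\<in>V. \<Sum>\<^sub>\<infinity>v\<in>V. ennreal_of_enat (graph_dist E u v) * ennreal (\<pi> u v)) =
      ennreal (idle_cost E x y \<pi>)" if "?T \<pi>" for \<pi>
    using transport_plan_support[OF that] transport_plan_idle_plan[OF that]
    by (intro infsum_cost) (auto simp: idle_plan_def finite_plan_def)
  have W: "wasserstein V E (idle_measure E p x) (idle_measure E p y) =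
      (INF \<pi>\<in>{\<pi>. ?T \<pi>}. ennreal (idle_cost E x y \<pi>))"
    unfolding wasserstein_def using cost by (intro INF_cong) auto
  show ?thesis
  proof (rule antisym)
    show "wasserstein V E (idle_measure E p x) (idle_measure E p y) \<le> ennreal (idle_distance E p x y)"
    \<comment> \<open>No optimal plan is at hand, so a plan within \<open>e\<close> of the infimum
      is used.\<close>
    proof (rule ennreal_le_epsilon)
      fix e :: real assume e: "0 < e"
      have "\<not> (\<forall>\<pi>. idle_plan E p x y \<pi> \<longrightarrow> idle_distance E p x y + e \<le> idle_cost E x y \<pi>)"
        using idle_distance_greatest[OF p, of "idle_distance E p x y + e"] e by auto
      then obtain \<pi> where \<pi>: "idle_plan E p x y \<pi>" "idle_cost E x y \<pi> \<le> idle_distance E p x y + e"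
        by force
      obtain \<pi>' where \<pi>': "?T \<pi>'" "idle_cost E x y \<pi>' = idle_cost E x y \<pi>"
        using idle_plan_transport_plan[OF p \<pi>(1)] .
      have "wasserstein V E (idle_measure E p x) (idle_measure E p y) \<le> ennreal (idle_cost E x y \<pi>')"
        unfolding W using \<pi>'(1) by (intro INF_lower) auto
      also have "\<dots> \<le> ennreal (idle_distance E p x y + e)" using \<pi> \<pi>' by (intro ennreal_leI) simp
      also have "\<dots> \<le> ennreal (idle_distance E p x y) + ennreal e"
        using e by (simp add: ennreal_plus_if)
      finally show "wasserstein V E (idle_measure E p x) (idle_measure E p y) \<le>
        ennreal (idle_distance E p x y) + ennreal e" .
    qed
    show "ennreal (idle_distance E p x y) \<le> wasserstein V E (idle_measure E p x) (idle_measure E p y)"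
      unfolding W using idle_distance_le transport_plan_idle_plan
      by (intro INF_greatest ennreal_leI) auto
  qed
qed

lemma idle_curvature_eq:
  assumes p: "p \<in> {0..1}"
  shows "idle_curvature V E p x y = ereal (1 - idle_distance E p x y)"
proof -
  have "0 \<le> idle_distance E p x y" by (rule idle_distance_greatest[OF p idle_cost_nonneg])
  then show ?thesis
    by (simp add: idle_curvature_def wasserstein_eq_idle_distance[OF p] enn2ereal_ennreal one_ereal_def)
qed

section \<open>Linearity of the curvature in the idleness\<close>

text \<open>Every plan for \<open>p\<close> can be made heavy and rescaled to \<open>p'\<close>,
  which bounds the distance at \<open>p'\<close>. The cross-multiplied form makes sense at
  \<open>p' = 1\<close> and, with \<open>p\<close> and \<open>p'\<close> exchanged, yields the
  reverse inequality.\<close>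

lemma idle_distance_rescale_le:
  defines "p0 \<equiv> 1 / (real (max (vertex_degree E x) (vertex_degree E y)) + 1)"
  assumes p: "p0 \<le> p" "p < 1" and p': "p0 \<le> p'" "p' \<le> 1"
  shows "(1 - p') * (1 - idle_distance E p x y) \<le> (1 - p) * (1 - idle_distance E p' x y)"
proof (cases "p' = 1")
  case True
  have p01: "0 \<le> p0" by (simp add: p0_def)
  obtain \<pi> where \<pi>: "idle_plan E p x y \<pi>" using idle_plan_exists[of p] p p01 by auto
  obtain \<pi>' where "idle_plan E 1 x y \<pi>'" "idle_cost E x y \<pi>' = 0 * idle_cost E x y \<pi> + (1 - 0)"
    by (rule rescale_plan[of p 0 1 \<pi>]) (use p \<pi> in auto)
  then have "idle_distance E 1 x y \<le> 1" using idle_distance_le[of 1 \<pi>'] by simp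
  then show ?thesis using True p by simp
next
  case False
  define D where "D = real (max (vertex_degree E x) (vertex_degree E y))"
  define t where "t = (1 - p') / (1 - p)"
  have D: "D \<ge> 1" using degree_pos by (simp add: D_def)
  have p01: "0 \<le> p0" by (simp add: p0_def)
  have t0: "t > 0" using False p p' by (simp add: t_def)
  have tp: "t * (1 - p) = 1 - p'" using p by (simp add: t_def)
  have bound: "1 - (1 - idle_distance E p' x y) / t \<le> idle_cost E x y \<pi>" if \<pi>: "idle_plan E p x y \<pi>" for \<pi>
  proof -
    obtain \<rho> where \<rho>: "idle_plan E p x y \<rho>" "idle_cost E x y \<rho> \<le> idle_cost E x y \<pi>"
      and heavy: "\<rho> x y \<ge> p - (1 - p) / D"
      using heavy_edge_plan[of p \<pi>] p \<pi> by (auto simp: p0_def D_def)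
    \<comment> \<open>Since \<open>t * (1 - p) = 1 - p'\<close>, this amounts to
      \<open>(1 - p') / D \<le> p'\<close>, that is, to \<open>p' \<ge> p0\<close>.\<close>
    have "t - 1 \<le> t * (p - (1 - p) / D)"
    proof -
      have "1 \<le> p' * (D + 1)" using p' D by (simp add: p0_def D_def field_simps)
      then have "(1 - p') / D \<le> p'" using D by (simp add: field_simps)
      moreover have "t * (p - (1 - p) / D) = t - t * (1 - p) - t * (1 - p) / D"
        by (simp add: algebra_simps)
      ultimately show ?thesis by (simp add: tp)
    qed
    also have "\<dots> \<le> t * \<rho> x y" using heavy t0 by simp
    finally obtain \<rho>' where \<rho>': "idle_plan E p' x y \<rho>'"
      "idle_cost E x y \<rho>' = t * idle_cost E x y \<rho> + (1 - t)"
      using rescale_plan[OF p(2) t_def _ \<rho>(1)] t0 by auto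
    have "idle_distance E p' x y \<le> t * idle_cost E x y \<rho> + (1 - t)"
      using idle_distance_le[OF \<rho>'(1)] \<rho>'(2) by simp
    also have "\<dots> \<le> t * idle_cost E x y \<pi> + (1 - t)" using \<rho>(2) t0 by simp
    finally show ?thesis using t0 by (simp add: field_simps)
  qed
  have "1 - (1 - idle_distance E p' x y) / t \<le> idle_distance E p x y"
    using p p01 by (intro idle_distance_greatest bound) auto
  then have "t * (1 - idle_distance E p x y) \<le> 1 - idle_distance E p' x y"
    using t0 by (simp add: field_simps)
  then have "(1 - p) * (t * (1 - idle_distance E p x y)) \<le> (1 - p) * (1 - idle_distance E p' x y)"
    using p by (intro mult_left_mono) auto
  then show ?thesis using tp by (simp add: mult.assoc[symmetric] mult.commute[of "1 - p"])
qed

text \<open>At idleness 1 both measures are point masses, so the unit mass must travel along the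
  edge.\<close>

lemma idle_distance_one: "idle_distance E 1 x y \<ge> 1"
proof (rule idle_distance_greatest)
  fix \<pi> assume plan: "idle_plan E 1 x y \<pi>"
  let ?F = "edge_nbhd E x y"
  have nn: "0 \<le> \<pi> u v" and row: "(\<Sum>v\<in>?F. \<pi> u v) = idle_measure E 1 x u"
    and col: "(\<Sum>u\<in>?F. \<pi> u v) = idle_measure E 1 y v" if "u \<in> ?F" "v \<in> ?F" for u v
    using plan that by (auto simp: idle_plan_def finite_plan_def)
  have "\<pi> x v = 0" if v: "v \<in> ?F - {y}" for v
  proof -
    have "\<pi> x v \<le> (\<Sum>u\<in>?F. \<pi> u v)"
      using nbhd nn v by (intro member_le_sum) auto
    then show ?thesis using col[of v v] nn[of x v] v nbhd by (simp add: idle_measure_def split: if_splits)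
  qed
  then have xy: "\<pi> x y = 1"
    using row[of x x] nbhd by (simp add: idle_measure_def sum.remove[of _ y])
  have "1 = real_dist E x y * \<pi> x y" using xy edge_real_dist by simp
  also have "\<dots> \<le> (\<Sum>v\<in>?F. real_dist E x v * \<pi> x v)"
    using nbhd nn real_dist_nonneg[of E] by (intro member_le_sum) auto
  also have "\<dots> \<le> idle_cost E x y \<pi>"
    unfolding idle_cost_def plan_cost_def
    using nbhd nn real_dist_nonneg[of E]
    by (intro member_le_sum[of x ?F "\<lambda>u. \<Sum>v\<in>?F. real_dist E u v * \<pi> u v"] sum_nonneg) auto
  finally show "1 \<le> idle_cost E x y \<pi>" .
qed simp

lemma curvature_linear:
  obtains c where "curvature V E x y = ereal c"
    "\<And>p. 1 / (real (max (vertex_degree E x) (vertex_degree E y)) + 1) \<le> p \<Longrightarrow> p \<le> 1 \<Longrightarrow>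
       idle_curvature V E p x y = ereal ((1 - p) * c)"
proof
  define p0 where "p0 = 1 / (real (max (vertex_degree E x) (vertex_degree E y)) + 1)"
  define c where "c = (1 - idle_distance E p0 x y) / (1 - p0)"
  have p0: "0 \<le> p0" "p0 < 1" using degree_pos by (auto simp: p0_def)
  show lin: "idle_curvature V E p x y = ereal ((1 - p) * c)" if p: "p0 \<le> p" "p \<le> 1" for p
  proof -
    have le: "(1 - p) * (1 - idle_distance E p0 x y) \<le> (1 - p0) * (1 - idle_distance E p x y)"
      using idle_distance_rescale_le[of p0 p] p p0 by (simp add: p0_def)
    have "(1 - p) * (1 - idle_distance E p0 x y) = (1 - p0) * (1 - idle_distance E p x y)"
    \<comment> \<open>Rescaling cannot start from idleness 1; there the reverse inequality comes
      from \<open>idle_distance_one\<close>.\<close>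
    proof (cases "p = 1")
      case True
      then show ?thesis using le p0 idle_distance_one by (simp add: zero_le_mult_iff)
    next
      case False
      have "(1 - p0) * (1 - idle_distance E p x y) \<le> (1 - p) * (1 - idle_distance E p0 x y)"
        using idle_distance_rescale_le[of p p0] p p0 False by (simp add: p0_def)
      with le show ?thesis by simp
    qed
    then have "1 - idle_distance E p x y = (1 - p) * c" using p0 by (simp add: c_def field_simps)
    then show ?thesis using idle_curvature_eq[of p] p p0 by simp
  qed
  \<comment> \<open>On the interval \<open>(p0, 1)\<close> the quotient is constant, so the limit
    exists and equals that constant.\<close>
  have "eventually (\<lambda>p. idle_curvature V E p x y / ereal (1 - p) = ereal c) (at_left 1)"
    using eventually_at_left_real[OF p0(2)]
  proof eventually_elim
    case (elim p)
    then show ?case using lin[of p] by simp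
  qed
  then have "((\<lambda>p. idle_curvature V E p x y / ereal (1 - p)) \<longlongrightarrow> ereal c) (at_left 1)"
    by (rule tendsto_eventually)
  then show "curvature V E x y = ereal c"
    unfolding curvature_def by (intro tendsto_Lim) auto
qed

end

theorem mainTheorem3:
  fixes V :: "'a set" and E :: "'a \<Rightarrow> 'a \<Rightarrow> bool"
  assumes "simple_graph V E" and "locally_finite V E"
  shows "(\<forall>x\<in>V. \<forall>y\<in>V. E x y \<longrightarrow>
            (\<forall>p \<in> {1 / (real (max (vertex_degree E x) (vertex_degree E y)) + 1) .. 1}.
               idle_curvature V E p x y = ereal (1 - p) * curvature V E x y))
       \<and> (\<forall>d. regular_graph V E d \<longrightarrow>
            (\<forall>x\<in>V. \<forall>y\<in>V. E x y \<longrightarrow>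
               curvature V E x y = 2 * idle_curvature V E (1 / 2) x y \<and>
               2 * idle_curvature V E (1 / 2) x y =
                 ereal ((real d + 1) / real d) * idle_curvature V E (1 / (real d + 1)) x y))"
proof (intro conjI allI impI ballI)
  have edge: "graph_edge V E x y" if "E x y" for x y
    using assms that by (simp add: graph_edge_def graph_edge_axioms_def)
  show "idle_curvature V E p x y = ereal (1 - p) * curvature V E x y"
    if "E x y" "p \<in> {1 / (real (max (vertex_degree E x) (vertex_degree E y)) + 1) .. 1}" for x y p
    using graph_edge.curvature_linear[OF edge[OF that(1)]] that(2)
    by (metis atLeastAtMost_iff times_ereal.simps(1))
  fix d x y assume reg: "regular_graph V E d" and V: "x \<in> V" "y \<in> V" and E: "E x y"
  interpret graph_edge V E x y by (rule edge[OF E])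
  have deg: "vertex_degree E x = d" "vertex_degree E y = d"
    using reg V by (auto simp: regular_graph_def)
  then have d: "d \<ge> 1" using degree_pos by simp
  obtain c where c: "curvature V E x y = ereal c"
    and lin: "\<And>p. 1 / (real d + 1) \<le> p \<Longrightarrow> p \<le> 1 \<Longrightarrow> idle_curvature V E p x y = ereal ((1 - p) * c)"
    using curvature_linear deg by auto
  \<comment> \<open>The value \<open>1 / 2\<close> is admissible because \<open>d \<ge> 1\<close>
    gives \<open>1 / (d + 1) \<le> 1 / 2\<close>.\<close>
  have half: "idle_curvature V E (1 / 2) x y = ereal (1 / 2 * c)"
    using lin[of "1 / 2"] d by (simp add: field_simps)
  have low: "idle_curvature V E (1 / (real d + 1)) x y = ereal ((1 - 1 / (real d + 1)) * c)"
    using lin[of "1 / (real d + 1)"] by simp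
  have gap: "1 - 1 / (real d + 1) = real d / (real d + 1)" by (simp add: field_simps)
  have two: "2 = ereal 2" by simp
  show "curvature V E x y = 2 * idle_curvature V E (1 / 2) x y"
    unfolding c half two by simp
  show "2 * idle_curvature V E (1 / 2) x y =
      ereal ((real d + 1) / real d) * idle_curvature V E (1 / (real d + 1)) x y"
    unfolding half low two gap using d by simp
qed

end
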